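(* Let $A\in\mathbb{R}^{m\times n}$ be a full-rank matrix whose rows $a_1^T,\dots,a_m^T$ have unit Euclidean norm, let $\hat x\in\mathbb{R}^n$, $\hat x\ne0$, put $\tilde b=A\hat x$, and let $b=\tilde b+b^c$, where $b^c\in\mathbb{R}^m$ satisfies $\|b^c\|_0=\beta m$. Let $\lambda>0$, $\beta<q<1-\beta$, and $$\gamma=\frac{1}{\tilde\sigma_{\min}^2}\cdot\frac{|\hat x|_{\min}+2\lambda}{|\hat x|_{\min}} .$$ Suppose the constant stepsize $w>0$ satisfies $$0<\frac{w}{\gamma qm}\left(\frac{\sigma_{q-\beta,\min}^2}{\sigma_{\max}^2}-\frac{\sqrt\beta}{\sqrt{1-q-\beta}}\right)-\frac{w^2\sigma_{\max}^2}{\gamma q^2m^2}\left(1+\frac{\sqrt\beta}{\sqrt{1-q-\beta}}\right)^2<1 .$$ Then for every $k\ge0$ the iterates of Quantile-RaSKA with constant stepsize $w$, run on $(A,b)$, satisfy $$D_f^{x_{k+1}^*}(x_{k+1},\hat x)\le\left[1-\frac{w}{\gamma qm}\left(\frac{\sigma_{q-\beta,\min}^2}{\sigma_{\max}^2}-\frac{\sqrt\beta}{\sqrt{1-q-\beta}}\right)+\frac{w^2\sigma_{\max}^2}{\gamma q^2m^2}\left(1+\frac{\sqrt\beta}{\sqrt{1-q-\beta}}\right)^2\right]D_f^{x_k^*}(x_k,\hat x).$$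
   Context: Notation. $\|\cdot\|$ is the Euclidean norm; $\|b^c\|_0$ is the number of nonzero entries; $|\hat x|_{\min}=\min\{|\hat x_j|:\hat x_j\ne0\}$. It is assumed that $\beta m$ and $qm$ are integers. For a matrix $M$, $\sigma_{\min}(M)=\min_{x\ne0}\|Mx\|/\|x\|$ and $\sigma_{\max}(M)=\max_{x\neq 0}\|Mx\|/\|x\|$; $\sigma_{\max}=\sigma_{\max}(A)$. Moreover $$\tilde\sigma_{\min}=\min\{\sigma_{\min}(A_J): J\subset\{1,\dots,n\},\ A_J\neq0\},$$ where $A_J$ is the submatrix of the columns of $A$ indexed by $J$, and $$\sigma_{q-\beta,\min}=\min\{\sigma_{\min}(A_I): I\subset\{1,\dots,m\},\ |I|=(q-\beta)m\},$$ where $A_I$ is here the submatrix of the rows of $A$ indexed by $I$. Function and Bregman distance. $f(x)=\lambda\|x\|_1+\frac12\|x\|^2$. For $x^*\in\partial f(x)$, $D_f^{x^*}(x,y)=f(y)-f(x)-\langle x^*,y-x\rangle$. The soft shrinkage $\mathcal S_\lambda(x)=\max\{|x|-\lambda,0\}\cdot\mathrm{sign}(x)$ is applied componentwise. Quantile. For reals $y_1,\dots,y_m$ sorted increasingly as $y_{(1)}\le\dots\le y_{(m)}$ and $qm$ an integer, the $q$-quantile is $(y_{(qm)}+y_{(qm+1)})/2$. Quantile-RaSKA with constant stepsize $w$. Start from $x_0=x_0^*=0$. At step $k$, let $Q_k$ be the $q$-quantile of the residuals $|\langle a_i,x_k\rangle-b_i|$, $1\le i\le m$; let $T=\{i:|\langle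 a_i,x_k\rangle-b_i|<Q_k\}$ and $\eta=|T|$ (it is understood that $\eta=qm$ at every step); set $$x_{k+1}^*=x_k^*-\frac{w}{\eta}\sum_{i\in T}(\langle a_i,x_k\rangle-b_i)\,a_i,\qquad x_{k+1}=\mathcal S_\lambda(x_{k+1}^* )$$ (so $x_k^*\in\partial f(x_k)$). *)

theory Defs
  imports "HOL-Analysis.Analysis"
begin

text \<open>
  The submatrix of \<open>A\<close> with row set \<open>I\<close> and column set \<open>J\<close> is kept in the type of \<open>A\<close> by padding
  with zeros. Zero rows do not change the norm of a product. Zero columns would force the minimum
  below to be 0, so the vectors in it are those of \<open>\<real>\<^sup>J\<close>, that is, those vanishing off \<open>J\<close>.
\<close>

definition submat :: "'m set \<Rightarrow> 'n set \<Rightarrow> real^'n^'m \<Rightarrow> real^'n^'m" where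
  "submat I J A = (\<chi> i j. if i \<in> I \<and> j \<in> J then A $ i $ j else 0)"

definition sigma_min :: "'m::finite set \<Rightarrow> 'n::finite set \<Rightarrow> real^'n^'m \<Rightarrow> real" where
  "sigma_min I J A =
     (INF x\<in>{x. x \<noteq> 0 \<and> (\<forall>j. j \<notin> J \<longrightarrow> x $ j = 0)}. norm (submat I J A *v x) / norm x)"

definition sigma_max :: "real^'n^'m \<Rightarrow> real" where
  "sigma_max A = (SUP x\<in>{x. x \<noteq> 0}. norm (A *v x) / norm x)"

definition sigma_tilde_min :: "real^'n^'m \<Rightarrow> real" where
  "sigma_tilde_min A = Min {sigma_min UNIV J A | J. submat UNIV J A \<noteq> 0}"

definition sigma_rows_min :: "real \<Rightarrow> real^'n^'m \<Rightarrow> real" where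
  "sigma_rows_min s A = Min {sigma_min I UNIV A | I. real (card I) = s * real CARD('m)}"

text \<open>The infimum and the supremum are a minimum and a maximum, as the notation suggests.\<close>

lemma sigma_min_attained:
  fixes A :: "real^'n^'m"
  assumes "J \<noteq> {}"
  shows "\<exists>x. x \<noteq> 0 \<and> (\<forall>j. j \<notin> J \<longrightarrow> x $ j = 0)
           \<and> sigma_min I J A = norm (submat I J A *v x) / norm x"
proof -
  let ?M = "submat I J A"
  let ?V = "{x::real^'n. \<forall>j. j \<notin> J \<longrightarrow> x $ j = 0}"
  have V: "closed ?V"
    by (intro closed_Collect_all closed_Collect_imp closed_Collect_eq continuous_intros) simp
  obtain l where l: "l \<in> J" using assms by auto
  have "axis l 1 $ j = (0::real)" if "j \<notin> J" for j
    using l that by (auto simp: axis_def)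
  then have "axis l 1 \<in> sphere 0 1 \<inter> ?V" by simp
  then have ne: "sphere 0 1 \<inter> ?V \<noteq> {}" by blast
  have "continuous_on (sphere 0 1 \<inter> ?V) (\<lambda>x. norm (?M *v x))"
    by (intro continuous_intros)
  moreover have "compact (sphere 0 1 \<inter> ?V)" using V by (simp add: compact_Int_closed)
  ultimately obtain u where "u \<in> sphere 0 1 \<inter> ?V"
    and le: "\<forall>v\<in>sphere 0 1 \<inter> ?V. norm (?M *v u) \<le> norm (?M *v v)"
    using continuous_attains_inf[of "sphere 0 1 \<inter> ?V" "\<lambda>x. norm (?M *v x)"] ne by blast
  then have u: "norm u = 1" "u \<in> ?V" by auto
  have min: "norm (?M *v u) \<le> norm (?M *v v)" if "norm v = 1" "v \<in> ?V" for v
    using le that by simp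
  have "sigma_min I J A = norm (?M *v u) / norm u"
    unfolding sigma_min_def
  proof (rule cInf_eq_minimum)
    show "norm (?M *v u) / norm u
      \<in> (\<lambda>x. norm (?M *v x) / norm x) ` {x. x \<noteq> 0 \<and> (\<forall>j. j \<notin> J \<longrightarrow> x $ j = 0)}"
      by (rule imageI) (use u in auto)
  next
    fix r assume "r \<in> (\<lambda>x. norm (?M *v x) / norm x) ` {x. x \<noteq> 0 \<and> (\<forall>j. j \<notin> J \<longrightarrow> x $ j = 0)}"
    then obtain x where x: "x \<noteq> 0" "x \<in> ?V" and r: "r = norm (?M *v x) / norm x" by auto
    have "norm (?M *v u) \<le> norm (?M *v ((1 / norm x) *\<^sub>R x))"
      by (rule min) (use x in auto)
    then show "norm (?M *v u) / norm u \<le> r"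
      using u r by (simp add: matrix_vector_mult_scaleR)
  qed
  then show ?thesis using u by (intro exI[of _ u]) auto
qed

lemma sigma_max_eq_onorm:
  fixes A :: "real^'n^'m"
  shows "sigma_max A = onorm ((*v) A)"
proof -
  have bl: "bounded_linear ((*v) A)" by (rule matrix_vector_mul_bounded_linear)
  have bdd: "bdd_above (range (\<lambda>x. norm (A *v x) / norm x))"
    using le_onorm[OF bl] by (auto intro!: bdd_aboveI[of _ "onorm ((*v) A)"])
  obtain a :: "real^'n" where a: "a \<noteq> 0" using axis_eq_0_iff[of undefined "1::real"] zero_neq_one by metis
  have bdd': "bdd_above ((\<lambda>x. norm (A *v x) / norm x) ` {x. x \<noteq> 0})"
    by (rule bdd_above_mono[OF bdd]) (rule image_mono, simp)
  show ?thesis unfolding sigma_max_def onorm_def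
  proof (rule antisym)
    show "(SUP x\<in>{x. x \<noteq> 0}. norm (A *v x) / norm x) \<le> (SUP x. norm (A *v x) / norm x)"
      by (rule cSUP_subset_mono) (use a bdd in auto)
    show "(SUP x. norm (A *v x) / norm x) \<le> (SUP x\<in>{x. x \<noteq> 0}. norm (A *v x) / norm x)"
    proof (rule cSUP_least)
      fix x
      show "norm (A *v x) / norm x \<le> (SUP x\<in>{x. x \<noteq> 0}. norm (A *v x) / norm x)"
      proof (cases "x = 0")
        case True
        then have "norm (A *v x) / norm x \<le> norm (A *v a) / norm a" by simp
        also have "\<dots> \<le> (SUP x\<in>{x. x \<noteq> 0}. norm (A *v x) / norm x)"
          by (rule cSUP_upper) (use a bdd' in auto)
        finally show ?thesis .
      qed (rule cSUP_upper, use bdd' in auto)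
    qed simp
  qed
qed

definition norm0 :: "real^'n \<Rightarrow> nat" where
  "norm0 x = card {j. x $ j \<noteq> 0}"

definition abs_min :: "real^'n \<Rightarrow> real" where
  "abs_min x = Min {\<bar>x $ j\<bar> | j. x $ j \<noteq> 0}"

definition obj :: "real \<Rightarrow> real^'n \<Rightarrow> real" where
  "obj l x = l * (\<Sum>j\<in>UNIV. \<bar>x $ j\<bar>) + (norm x)\<^sup>2 / 2"

definition bregman :: "('a::real_inner \<Rightarrow> real) \<Rightarrow> 'a \<Rightarrow> 'a \<Rightarrow> 'a \<Rightarrow> real" where
  "bregman f xs x y = f y - f x - xs \<bullet> (y - x)"

definition shrink :: "real \<Rightarrow> real^'n \<Rightarrow> real^'n" where
  "shrink l x = (\<chi> j. max (\<bar>x $ j\<bar> - l) 0 * sgn (x $ j))"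

text \<open>
  The distance \<^const>\<open>bregman\<close> is meant for subgradients \<open>xs\<close> of \<open>f\<close> at \<open>x\<close>. The iteration below
  only produces such pairs, since every \<open>s\<close> is a subgradient of the objective at \<open>shrink l s\<close>.
\<close>

lemma shrink_subgradient:
  assumes "l \<ge> 0"
  shows "obj l (shrink l s) + s \<bullet> (y - shrink l s) \<le> obj l y"
proof -
  have *: "l * \<bar>z\<bar> + z\<^sup>2 / 2 + t * (v - z) \<le> l * \<bar>v\<bar> + v\<^sup>2 / 2"
    if z: "z = max (\<bar>t\<bar> - l) 0 * sgn t" for t v z :: real
  proof -
    have tv: "(t - z) * v \<le> l * \<bar>v\<bar>"
    proof -
      have "\<bar>t - z\<bar> \<le> l" using z assms by (auto simp: max_def sgn_if abs_if split: if_splits)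
      then have "\<bar>t - z\<bar> * \<bar>v\<bar> \<le> l * \<bar>v\<bar>" by (rule mult_right_mono) simp
      then show ?thesis using abs_ge_self[of "(t - z) * v"] by (simp add: abs_mult)
    qed
    have tz: "(t - z) * z = l * \<bar>z\<bar>"
      using z assms by (auto simp: max_def sgn_if abs_if algebra_simps split: if_splits)
    have "0 \<le> (v - z)\<^sup>2" by simp
    then show ?thesis using tv tz by (simp add: power2_eq_square algebra_simps)
  qed
  have o: "obj l x = (\<Sum>j\<in>UNIV. l * \<bar>x $ j\<bar> + (x $ j)\<^sup>2 / 2)" for x :: "real^'n"
  proof -
    have "(norm x)\<^sup>2 = (\<Sum>j\<in>UNIV. (x $ j)\<^sup>2)"
      unfolding power2_norm_eq_inner by (simp add: inner_vec_def power2_eq_square)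
    then show ?thesis by (simp add: obj_def sum.distrib sum_distrib_left sum_divide_distrib)
  qed
  show ?thesis
    unfolding o inner_vec_def sum.distrib[symmetric]
    by (rule sum_mono) (use * in \<open>simp add: shrink_def\<close>)
qed

text \<open>Positions count from 1, and repeated values keep their multiplicity.\<close>

definition order_stat :: "real^'m \<Rightarrow> nat \<Rightarrow> real" where
  "order_stat y k = sorted_list_of_multiset (image_mset (($) y) (mset_set UNIV)) ! (k - 1)"

text \<open>The quantile is meant for integral \<open>q * m\<close>; the floor then only changes the type.\<close>

definition quantile :: "real \<Rightarrow> real^'m \<Rightarrow> real" where
  "quantile q y =
     (let p = nat \<lfloor>q * real CARD('m)\<rfloor> in (order_stat y p + order_stat y (p + 1)) / 2)"

definition abs_residuals :: "real^'n^'m \<Rightarrow> real^'m \<Rightarrow> real^'n \<Rightarrow> real^'m" where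
  "abs_residuals A b x = (\<chi> i. \<bar>row i A \<bullet> x - b $ i\<bar>)"

definition accepted :: "real \<Rightarrow> real^'n^'m \<Rightarrow> real^'m \<Rightarrow> real^'n \<Rightarrow> 'm set" where
  "accepted q A b x = {i. abs_residuals A b x $ i < quantile q (abs_residuals A b x)}"

text \<open>The \<open>k\<close>-th state is the pair of the dual iterate and the primal iterate.\<close>

primrec raska ::
  "real \<Rightarrow> real \<Rightarrow> real \<Rightarrow> real^'n^'m \<Rightarrow> real^'m \<Rightarrow> nat \<Rightarrow> (real^'n) \<times> (real^'n)" where
  "raska l q w A b 0 = (0, 0)"
| "raska l q w A b (Suc k) =
     (let (xs, x) = raska l q w A b k;
          T = accepted q A b x;
          xs' = xs - (w / real (card T)) *\<^sub>R (\<Sum>i\<in>T. (row i A \<bullet> x - b $ i) *\<^sub>R row i A)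
      in (xs', shrink l xs'))"

definition raska_dual ::
  "real \<Rightarrow> real \<Rightarrow> real \<Rightarrow> real^'n^'m \<Rightarrow> real^'m \<Rightarrow> nat \<Rightarrow> real^'n" where
  "raska_dual l q w A b k = fst (raska l q w A b k)"

definition raska_primal ::
  "real \<Rightarrow> real \<Rightarrow> real \<Rightarrow> real^'n^'m \<Rightarrow> real^'m \<Rightarrow> nat \<Rightarrow> real^'n" where
  "raska_primal l q w A b k = snd (raska l q w A b k)"

end

theory Submission
  imports Defs
begin

text \<open>
  Write \<open>u = x\<^sub>k - xhat\<close>. Since \<open>obj l\<close> is 1-strongly convex, a dual step \<open>d\<close> changes the Bregman
  distance to \<open>xhat\<close> by at most \<open>u \<bullet> d + \<parallel>d\<parallel>\<^sup>2 / 2\<close>. A corrupted row that is accepted has a residual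
  below the quantile, which in turn lies below the residuals of the many rejected uncorrupted rows.
  So corruption costs only a fraction \<open>\<surd>\<beta> / \<surd>(1 - q - \<beta>)\<close> of \<open>\<parallel>A u\<parallel>\<^sup>2\<close>, and the decrease is a multiple
  of \<open>\<parallel>A u\<parallel>\<^sup>2\<close>. Finally the Bregman distance is at most \<open>\<gamma> \<parallel>A u\<parallel>\<^sup>2\<close>, since coordinatewise it is at
  most \<open>(1 / 2 + 2 l / \<bar>xhat\<bar>\<^sub>m\<^sub>i\<^sub>n) u\<^sub>j\<^sup>2\<close>.
\<close>

section \<open>Soft shrinkage, strong convexity and the Bregman distance\<close>

lemma power2_norm_eq_sum: "(norm x)\<^sup>2 = (\<Sum>j\<in>UNIV. (x $ j)\<^sup>2)" for x :: "real^'n"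
  unfolding power2_norm_eq_inner by (simp add: inner_vec_def power2_eq_square)

lemma obj_eq_sum: "obj l x = (\<Sum>j\<in>UNIV. l * \<bar>x $ j\<bar> + (x $ j)\<^sup>2 / 2)"
  by (simp add: obj_def power2_norm_eq_sum sum.distrib sum_distrib_left sum_divide_distrib)

text \<open>In each coordinate \<open>t - z\<close> is a subgradient of
  \<open>l * \<bar>.\<bar>\<close> at \<open>z\<close>, and the expansion of the quadratic part
  about \<open>z\<close> is exact. Keeping its square term gives the extra
  \<open>(norm (y - shrink l s))\<^sup>2 / 2\<close>, which later absorbs the unknown primal
  step.\<close>

lemma shrink_strong_subgradient:
  assumes "l \<ge> 0"
  shows "obj l (shrink l s) + s \<bullet> (y - shrink l s) + (norm (y - shrink l s))\<^sup>2 / 2 \<le> obj l y"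
proof -
  have *: "l * \<bar>z\<bar> + z\<^sup>2 / 2 + t * (v - z) + (v - z)\<^sup>2 / 2 \<le> l * \<bar>v\<bar> + v\<^sup>2 / 2"
    if z: "z = max (\<bar>t\<bar> - l) 0 * sgn t" for t v z :: real
  proof -
    have tv: "(t - z) * v \<le> l * \<bar>v\<bar>"
    proof -
      have "\<bar>t - z\<bar> \<le> l" using z assms by (auto simp: max_def sgn_if abs_if split: if_splits)
      then have "\<bar>t - z\<bar> * \<bar>v\<bar> \<le> l * \<bar>v\<bar>" by (rule mult_right_mono) simp
      then show ?thesis using abs_ge_self[of "(t - z) * v"] by (simp add: abs_mult)
    qed
    have tz: "(t - z) * z = l * \<bar>z\<bar>"
      using z assms by (auto simp: max_def sgn_if abs_if algebra_simps split: if_splits)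
    show ?thesis using tv tz by (simp add: power2_eq_square field_simps)
  qed
  show ?thesis
    unfolding obj_eq_sum inner_vec_def power2_norm_eq_sum sum_divide_distrib sum.distrib[symmetric]
    by (rule sum_mono) (use * in \<open>simp add: shrink_def\<close>)
qed

text \<open>A three-point identity leaves \<open>d \<bullet> e\<close> minus a Bregman distance
  between consecutive points. Strong convexity bounds that distance below by
  \<open>(norm e)\<^sup>2 / 2\<close>, and Young's inequality for \<open>d \<bullet> e\<close>
  cancels this term, so only the dual step \<open>d\<close> remains.\<close>

lemma bregman_shrink_descent:
  assumes "l \<ge> 0"
  shows "bregman (obj l) s' (shrink l s') y
    \<le> bregman (obj l) s (shrink l s) y + (shrink l s - y) \<bullet> (s' - s) + (norm (s' - s))\<^sup>2 / 2"
proof -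
  define x x' d e where "x = shrink l s" and "x' = shrink l s'" and "d = s' - s" and "e = x' - x"
  have "bregman (obj l) s' x' y
    = bregman (obj l) s x y + (x - y) \<bullet> d + (d \<bullet> e + (obj l x + s \<bullet> e - obj l x'))"
    unfolding bregman_def d_def e_def
    by (simp add: inner_diff_left inner_diff_right inner_commute)
  moreover have "obj l x + s \<bullet> e + (norm e)\<^sup>2 / 2 \<le> obj l x'"
    unfolding x_def e_def x'_def by (rule shrink_strong_subgradient[OF assms])
  moreover have "d \<bullet> e \<le> (norm d)\<^sup>2 / 2 + (norm e)\<^sup>2 / 2"
  proof -
    have "(norm (d - e))\<^sup>2 = (norm d)\<^sup>2 - 2 * (d \<bullet> e) + (norm e)\<^sup>2"
      by (simp add: power2_norm_eq_inner inner_diff_left inner_diff_right inner_commute)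
    moreover have "0 \<le> (norm (d - e))\<^sup>2" by simp
    ultimately show ?thesis by linarith
  qed
  ultimately show ?thesis unfolding x_def x'_def d_def by linarith
qed

lemma abs_min_pos: "y \<noteq> 0 \<Longrightarrow> abs_min y > 0"
  and abs_min_le: "y $ j \<noteq> 0 \<Longrightarrow> abs_min y \<le> \<bar>y $ j\<bar>"
proof -
  have fin: "finite {\<bar>y $ j\<bar> | j. y $ j \<noteq> 0}"
    by simp
  show "abs_min y > 0" if "y \<noteq> 0"
  proof -
    have "{\<bar>y $ j\<bar> | j. y $ j \<noteq> 0} \<noteq> {}" using that by (auto simp: vec_eq_iff)
    with fin show ?thesis unfolding abs_min_def by (subst Min_gr_iff) auto
  qed
  show "abs_min y \<le> \<bar>y $ j\<bar>" if "y $ j \<noteq> 0"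
    unfolding abs_min_def by (rule Min_le[OF fin]) (use that in blast)
qed

text \<open>The quadratic part contributes exactly half the squared distance. The rest,
  \<open>l * \<bar>v\<bar> - (t - z) * v\<close>, vanishes if \<open>v = 0\<close> or if
  \<open>z\<close> and \<open>v\<close> have the same strict sign, because then \<open>t - z\<close>
  is \<open>l\<close> times that sign. Otherwise it is at most \<open>2 * l * \<bar>v\<bar>\<close>,
  and the lower bound \<open>c\<close> on \<open>\<bar>v\<bar>\<close> turns this linear term into a
  quadratic one.\<close>

lemma bregman_shrink_le_norm:
  fixes s y :: "real^'n"
  assumes "l \<ge> 0" "y \<noteq> 0"
  shows "bregman (obj l) s (shrink l s) y
    \<le> (1 / 2 + 2 * l / abs_min y) * (norm (shrink l s - y))\<^sup>2"
proof -
  define c where "c = abs_min y"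
  have c: "c > 0" using abs_min_pos[OF assms(2)] by (simp add: c_def)
  have *: "l * \<bar>v\<bar> + v\<^sup>2 / 2 - (l * \<bar>z\<bar> + z\<^sup>2 / 2) - t * (v - z) \<le> (1 / 2 + 2 * l / c) * (z - v)\<^sup>2"
    if z: "z = max (\<bar>t\<bar> - l) 0 * sgn t" and v: "v \<noteq> 0 \<Longrightarrow> c \<le> \<bar>v\<bar>" for t v z :: real
  proof -
    have tz: "(t - z) * z = l * \<bar>z\<bar>" and tl: "\<bar>t - z\<bar> \<le> l"
      using z assms(1) by (auto simp: max_def sgn_if abs_if algebra_simps split: if_splits)
    have eq: "l * \<bar>v\<bar> + v\<^sup>2 / 2 - (l * \<bar>z\<bar> + z\<^sup>2 / 2) - t * (v - z)
      = (z - v)\<^sup>2 / 2 + (l * \<bar>v\<bar> - (t - z) * v)"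
      using tz by (simp add: power2_eq_square field_simps)
    have "l * \<bar>v\<bar> - (t - z) * v \<le> 2 * l / c * (z - v)\<^sup>2"
    proof (cases "z * v > 0 \<or> v = 0")
      case True
      then consider "v = 0" | "z > 0" "v > 0" | "z < 0" "v < 0" by (auto simp: zero_less_mult_iff)
      then have "l * \<bar>v\<bar> - (t - z) * v = 0"
      proof cases
        case 2
        then have "t - z = l" using tz by simp
        with 2 show ?thesis by simp
      next
        case 3
        then have "(t - z) * z = (- l) * z" using tz by simp
        with 3 have "t - z = - l" by (simp only: mult_cancel_right) simp
        with 3 show ?thesis by simp
      qed simp
      then show ?thesis using c assms(1) by simp
    next
      case False
      have cv: "c \<le> \<bar>v\<bar>" using v False by auto
      \<comment> \<open>Here \<open>z * v \<le> 0\<close>, so 0 lies between \<open>z\<close> and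
        \<open>v\<close>.\<close>
      have "\<bar>v\<bar> \<le> \<bar>z - v\<bar>" using False by (auto simp: abs_if zero_less_mult_iff)
      then have "\<bar>v\<bar> * \<bar>v\<bar> \<le> (z - v)\<^sup>2"
        using mult_mono[of "\<bar>v\<bar>" "\<bar>z - v\<bar>" "\<bar>v\<bar>" "\<bar>z - v\<bar>"] by (simp add: power2_eq_square)
      moreover have "c * \<bar>v\<bar> \<le> \<bar>v\<bar> * \<bar>v\<bar>" using cv by (rule mult_right_mono) simp
      ultimately have "c * \<bar>v\<bar> \<le> (z - v)\<^sup>2" by linarith
      then have "\<bar>v\<bar> \<le> (z - v)\<^sup>2 / c" using c by (simp add: field_simps)
      then have "2 * l * \<bar>v\<bar> \<le> 2 * l * ((z - v)\<^sup>2 / c)"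
        by (rule mult_left_mono) (use assms in simp)
      moreover have "\<bar>t - z\<bar> * \<bar>v\<bar> \<le> l * \<bar>v\<bar>" using tl by (rule mult_right_mono) simp
      then have "- ((t - z) * v) \<le> l * \<bar>v\<bar>"
        using abs_ge_minus_self[of "(t - z) * v"] by (simp add: abs_mult)
      ultimately show ?thesis by simp
    qed
    then show ?thesis unfolding eq by (simp add: algebra_simps)
  qed
  show ?thesis
    unfolding bregman_def obj_eq_sum inner_vec_def power2_norm_eq_sum sum_distrib_left
      sum_subtractf[symmetric] c_def[symmetric]
    by (rule sum_mono) (use * abs_min_le[of y] in \<open>simp add: shrink_def c_def\<close>)
qed

section \<open>Singular value bounds\<close>

lemma submat_UNIV_vector_nth:
  "(submat I UNIV A *v x) $ i = (if i \<in> I then row i A \<bullet> x else 0)"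
  by (simp add: submat_def matrix_vector_mult_def row_def inner_vec_def)

lemma submat_UNIV_UNIV [simp]: "submat UNIV UNIV A = A"
  by (simp add: submat_def vec_eq_iff)

lemma sigma_min_UNIV_le: "sigma_min I UNIV A * norm x \<le> norm (submat I UNIV A *v x)"
  for A :: "real^'n^'m"
proof (cases "x = 0")
  case False
  have "sigma_min I UNIV A \<le> norm (submat I UNIV A *v x) / norm x"
    unfolding sigma_min_def
    by (rule cINF_lower) (use False in \<open>auto intro!: bdd_belowI[of _ 0]\<close>)
  then show ?thesis using False by (simp add: field_simps)
qed simp

lemma sigma_min_UNIV_nonneg: "0 \<le> sigma_min I UNIV (A :: real^'n^'m)"
  using sigma_min_attained[of UNIV I A] by (auto simp del: submat_UNIV_UNIV)

text \<open>As \<open>A\<close> is nonzero, the full column set is one of those over which the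
  minimum is taken.\<close>

lemma sigma_tilde_min_le:
  fixes A :: "real^'n^'m"
  assumes "A \<noteq> 0"
  shows "sigma_tilde_min A * norm x \<le> norm (A *v x)"
proof -
  have "sigma_tilde_min A \<le> sigma_min UNIV UNIV A"
    unfolding sigma_tilde_min_def
  proof (rule Min_le)
    show "sigma_min UNIV UNIV A \<in> {sigma_min UNIV J A |J. submat UNIV J A \<noteq> 0}"
      using assms by (intro CollectI exI[of _ UNIV]) simp
  qed simp
  then have "sigma_tilde_min A * norm x \<le> sigma_min UNIV UNIV A * norm x"
    by (rule mult_right_mono) simp
  also have "\<dots> \<le> norm (A *v x)" using sigma_min_UNIV_le[of UNIV A x] by simp
  finally show ?thesis .
qed

lemma sigma_tilde_min_nonneg:
  fixes A :: "real^'n^'m"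
  assumes "A \<noteq> 0"
  shows "0 \<le> sigma_tilde_min A"
  unfolding sigma_tilde_min_def
proof (subst Min_ge_iff)
  show "{sigma_min UNIV J A |J. submat UNIV J A \<noteq> 0} \<noteq> {}"
    using assms by (auto intro!: exI[of _ UNIV])
  show "\<forall>a\<in>{sigma_min UNIV J A |J. submat UNIV J A \<noteq> 0}. 0 \<le> a"
  proof clarify
    fix J assume "submat UNIV J A \<noteq> 0"
    \<comment> \<open>For empty \<open>J\<close> the infimum would range over the empty set, and
      nothing would be known of its value.\<close>
    then have "J \<noteq> {}" by (auto simp: submat_def vec_eq_iff)
    from sigma_min_attained[OF this, of UNIV A] show "0 \<le> sigma_min UNIV J A" by auto
  qed
qed simp

text \<open>The minimum ranges over row sets of size exactly \<open>p\<close>. A larger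
  \<open>I\<close> contains such a set \<open>K\<close>, and its further rows only add
  squares.\<close>

lemma sigma_rows_min_le:
  fixes A :: "real^'n^'m"
  assumes p: "s * real CARD('m) = real p" and I: "p \<le> card I"
  shows "(sigma_rows_min s A)\<^sup>2 * (norm x)\<^sup>2 \<le> (\<Sum>i\<in>I. (row i A \<bullet> x)\<^sup>2)"
proof -
  let ?S = "{sigma_min I UNIV A | I. real (card I) = s * real CARD('m)}"
  obtain K where K: "K \<subseteq> I" "card K = p" using I by (meson obtain_subset_with_card_n)
  have mem: "sigma_min K UNIV A \<in> ?S" using K p by auto
  have le: "sigma_rows_min s A \<le> sigma_min K UNIV A"
    unfolding sigma_rows_min_def by (rule Min_le) (use mem in simp_all)
  have ge: "0 \<le> sigma_rows_min s A"
    unfolding sigma_rows_min_def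
    by (subst Min_ge_iff) (use mem in \<open>auto simp: sigma_min_UNIV_nonneg\<close>)
  have "sigma_rows_min s A * norm x \<le> norm (submat K UNIV A *v x)"
    using mult_right_mono[OF le, of "norm x"] sigma_min_UNIV_le[of K A x] by simp
  then have "(sigma_rows_min s A * norm x)\<^sup>2 \<le> (norm (submat K UNIV A *v x))\<^sup>2"
    by (rule power_mono) (use ge in simp)
  also have "\<dots> = (\<Sum>i\<in>K. (row i A \<bullet> x)\<^sup>2)"
    unfolding power2_norm_eq_sum submat_UNIV_vector_nth
    by (simp add: if_distrib[of "\<lambda>z. z\<^sup>2"] sum.If_cases cong: if_cong)
  also have "\<dots> \<le> (\<Sum>i\<in>I. (row i A \<bullet> x)\<^sup>2)"
    by (rule sum_mono2) (use K in auto)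
  finally show ?thesis by (simp add: power_mult_distrib)
qed

lemma norm_matrix_vector_le_sigma_max: "norm (A *v x) \<le> sigma_max A * norm x"
  for A :: "real^'n^'m"
  unfolding sigma_max_eq_onorm by (rule onorm[OF matrix_vector_mul_bounded_linear])

text \<open>With \<open>y\<close> the image of \<open>v\<close> under the transpose, the squared
  norm of \<open>y\<close> is \<open>v \<bullet> (A *v y)\<close>. Cauchy-Schwarz bounds it, and one
  factor \<open>norm y\<close> cancels.\<close>

lemma norm_transpose_le_sigma_max: "norm (transpose A *v v) \<le> sigma_max A * norm v"
  for A :: "real^'n^'m"
proof -
  let ?y = "transpose A *v v"
  have "norm ?y * norm ?y = v \<bullet> (A *v ?y)"
    by (metis dot_lmul_matrix power2_eq_square power2_norm_eq_inner vector_transpose_matrix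
        transpose_matrix_vector)
  also have "\<dots> \<le> norm v * norm (A *v ?y)" by (rule norm_cauchy_schwarz)
  also have "\<dots> \<le> norm v * (sigma_max A * norm ?y)"
    by (intro mult_left_mono norm_matrix_vector_le_sigma_max) simp
  finally have "norm ?y * norm ?y \<le> (sigma_max A * norm v) * norm ?y" by (simp add: mult_ac)
  moreover have "0 \<le> sigma_max A * norm v"
    unfolding sigma_max_eq_onorm by (simp add: onorm_pos_le[OF matrix_vector_mul_bounded_linear])
  ultimately show ?thesis by (cases "norm ?y = 0") auto
qed

text \<open>The sum is the transpose of \<open>A\<close> applied to the vector \<open>v\<close> that
  extends \<open>r\<close> by zero off \<open>T\<close>.\<close>

lemma norm_sum_rows_le_sigma_max:
  fixes A :: "real^'n^'m"
  shows "(norm (\<Sum>i\<in>T. r i *\<^sub>R row i A))\<^sup>2 \<le> (sigma_max A)\<^sup>2 * (\<Sum>i\<in>T. (r i)\<^sup>2)"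
proof -
  define v :: "real^'m" where "v = (\<chi> i. if i \<in> T then r i else 0)"
  have "(\<Sum>i\<in>T. r i *\<^sub>R row i A) = transpose A *v v"
  proof -
    have "(\<Sum>i\<in>T. r i *\<^sub>R row i A) = (\<Sum>i\<in>UNIV. v $ i *\<^sub>R row i A)"
      unfolding v_def by (rule sum.mono_neutral_cong_left) auto
    then show ?thesis
      by (simp add: vec_eq_iff matrix_vector_mult_def transpose_def row_def mult.commute)
  qed
  moreover have "(norm v)\<^sup>2 = (\<Sum>i\<in>T. (r i)\<^sup>2)"
    unfolding power2_norm_eq_sum v_def
    by (simp add: if_distrib[of "\<lambda>z. z\<^sup>2"] sum.If_cases cong: if_cong)
  ultimately show ?thesis
    using power_mono[OF norm_transpose_le_sigma_max[of A v], of 2] by (simp add: power_mult_distrib)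
qed

section \<open>Effect of corrupted rows on the accepted residuals\<close>

text \<open>
  In the next two lemmas \<open>c\<close> is the uncorrupted residual, \<open>r\<close> the observed one, \<open>B\<close> the set of
  corrupted rows and \<open>Q\<close> the acceptance threshold. Enough uncorrupted rows are rejected for \<open>Q\<close>,
  and with it every accepted corrupted residual, to be controlled by \<open>c\<close>.
\<close>

lemma accepted_corrupted_le:
  fixes c r :: "'m::finite \<Rightarrow> real"
  assumes rc: "\<And>i. i \<notin> B \<Longrightarrow> r i = c i"
    and T: "\<And>i. i \<in> T \<longleftrightarrow> \<bar>r i\<bar> < Q" "T \<noteq> {}"
    and card: "real (card T) = q * real CARD('m)" "real (card B) = \<beta> * real CARD('m)"
    and q: "q < 1 - \<beta>"
  shows "(\<Sum>i\<in>T \<inter> B. (r i)\<^sup>2) \<le> (sqrt \<beta> / sqrt (1 - q - \<beta>))\<^sup>2 * (\<Sum>i\<in>- T - B. (c i)\<^sup>2)"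
proof -
  let ?M = "real CARD('m)"
  have M: "?M > 0" by simp
  have \<beta>: "\<beta> \<ge> 0" using card(2) M by (metis of_nat_0_le_iff zero_le_mult_iff not_less)
  \<comment> \<open>Any accepted row has a nonnegative residual below \<open>Q\<close>. Positivity
    makes it possible to square the threshold inequalities.\<close>
  have Q: "Q > 0" using T by (metis abs_ge_zero all_not_in_conv le_less_trans)
  have "CARD('m) \<le> card T + card B + card (- T - B)"
  proof -
    have "UNIV = T \<union> B \<union> (- T - B)" by auto
    then show ?thesis by (metis card_Un_le order_trans add_le_mono1)
  qed
  then have "?M \<le> real (card T) + real (card B) + real (card (- T - B))"
    by (metis of_nat_add of_nat_mono)
  \<comment> \<open>Counting: what is neither accepted nor corrupted makes up at least a fraction
    \<open>1 - q - \<beta>\<close> of all rows. Each such row satisfies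
    \<open>Q \<le> \<bar>c i\<bar>\<close>.\<close>
  then have cN: "(1 - q - \<beta>) * ?M \<le> real (card (- T - B))"
    using card by (simp add: algebra_simps)
  have "(1 - q - \<beta>) * ?M * Q\<^sup>2 \<le> real (card (- T - B)) * Q\<^sup>2"
    using cN by (rule mult_right_mono) simp
  also have "\<dots> = (\<Sum>i\<in>- T - B. Q\<^sup>2)" by simp
  also have "\<dots> \<le> (\<Sum>i\<in>- T - B. (c i)\<^sup>2)"
  proof (rule sum_mono)
    fix i assume i: "i \<in> - T - B"
    then have "Q \<le> \<bar>r i\<bar>" using T(1)[of i] by auto
    then have "Q \<le> \<bar>c i\<bar>" using rc i by auto
    then show "Q\<^sup>2 \<le> (c i)\<^sup>2" using Q by (metis abs_le_square_iff abs_of_pos)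
  qed
  finally have N: "?M * Q\<^sup>2 \<le> (\<Sum>i\<in>- T - B. (c i)\<^sup>2) / (1 - q - \<beta>)"
    using q by (simp add: field_simps)
  have "(\<Sum>i\<in>T \<inter> B. (r i)\<^sup>2) \<le> (\<Sum>i\<in>T \<inter> B. Q\<^sup>2)"
  proof (rule sum_mono)
    fix i assume "i \<in> T \<inter> B"
    then have "\<bar>r i\<bar> \<le> \<bar>Q\<bar>" using T(1)[of i] by auto
    then show "(r i)\<^sup>2 \<le> Q\<^sup>2" by (simp add: abs_le_square_iff)
  qed
  also have "\<dots> = real (card (T \<inter> B)) * Q\<^sup>2" by simp
  also have "\<dots> \<le> real (card B) * Q\<^sup>2"
    by (intro mult_right_mono) (auto intro: card_mono)
  also have "\<dots> = \<beta> * (?M * Q\<^sup>2)" using card by simp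
  also have "\<dots> \<le> \<beta> * ((\<Sum>i\<in>- T - B. (c i)\<^sup>2) / (1 - q - \<beta>))"
    using N \<beta> by (rule mult_left_mono)
  finally show ?thesis using \<beta> q by (simp add: power_divide)
qed

lemma accepted_sums_bounds:
  fixes c r :: "'m::finite \<Rightarrow> real"
  assumes rc: "\<And>i. i \<notin> B \<Longrightarrow> r i = c i"
    and \<kappa>: "0 \<le> \<kappa>" "(\<Sum>i\<in>T \<inter> B. (r i)\<^sup>2) \<le> \<kappa>\<^sup>2 * (\<Sum>i\<in>- T - B. (c i)\<^sup>2)"
  shows "(\<Sum>i\<in>T - B. (c i)\<^sup>2) - \<kappa> * (\<Sum>i\<in>UNIV. (c i)\<^sup>2) \<le> (\<Sum>i\<in>T. c i * r i)"
    and "(\<Sum>i\<in>T. (r i)\<^sup>2) \<le> (1 + \<kappa>)\<^sup>2 * (\<Sum>i\<in>UNIV. (c i)\<^sup>2)"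
proof -
  let ?C = "\<Sum>i\<in>UNIV. (c i)\<^sup>2"
  have sub: "(\<Sum>i\<in>S. (c i)\<^sup>2) \<le> ?C" for S by (rule sum_mono2) auto
  have split: "sum g T = sum g (T - B) + sum g (T \<inter> B)" for g :: "'m \<Rightarrow> real"
    by (metis sum.Int_Diff add.commute finite)
  have C: "0 \<le> ?C" by (rule sum_nonneg) simp
  have r2: "(\<Sum>i\<in>T \<inter> B. (r i)\<^sup>2) \<le> \<kappa>\<^sup>2 * ?C"
    using \<kappa>(2) mult_left_mono[OF sub[of "- T - B"], of "\<kappa>\<^sup>2"] by simp
  \<comment> \<open>Cauchy-Schwarz on the accepted corrupted rows: the factor with \<open>c\<close>
    is at most \<open>?C\<close>, the one with \<open>r\<close> at most
    \<open>\<kappa>\<^sup>2 * ?C\<close>.\<close>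
  have "\<bar>\<Sum>i\<in>T \<inter> B. c i * r i\<bar> \<le> \<kappa> * ?C"
  proof (rule power2_le_imp_le)
    have "\<bar>\<Sum>i\<in>T \<inter> B. c i * r i\<bar>\<^sup>2 \<le> (\<Sum>i\<in>T \<inter> B. (c i)\<^sup>2) * (\<Sum>i\<in>T \<inter> B. (r i)\<^sup>2)"
      using Cauchy_Schwarz_ineq_sum[of c r "T \<inter> B"] by simp
    also have "\<dots> \<le> ?C * (\<kappa>\<^sup>2 * ?C)"
      by (intro mult_mono sub r2 C sum_nonneg) simp
    finally show "\<bar>\<Sum>i\<in>T \<inter> B. c i * r i\<bar>\<^sup>2 \<le> (\<kappa> * ?C)\<^sup>2"
      by (simp add: power2_eq_square mult_ac)
  qed (use \<kappa> C in simp)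
  moreover have "(\<Sum>i\<in>T - B. c i * r i) = (\<Sum>i\<in>T - B. (c i)\<^sup>2)"
    by (rule sum.cong) (auto simp: rc power2_eq_square)
  ultimately show "(\<Sum>i\<in>T - B. (c i)\<^sup>2) - \<kappa> * ?C \<le> (\<Sum>i\<in>T. c i * r i)"
    unfolding split[of "\<lambda>i. c i * r i"] by linarith
  have "(\<Sum>i\<in>T. (r i)\<^sup>2) = (\<Sum>i\<in>T - B. (c i)\<^sup>2) + (\<Sum>i\<in>T \<inter> B. (r i)\<^sup>2)"
    unfolding split[of "\<lambda>i. (r i)\<^sup>2"] by (simp add: rc)
  also have "\<dots> \<le> ?C + \<kappa>\<^sup>2 * ?C" by (intro add_mono sub r2)
  \<comment> \<open>The cross term \<open>2 * \<kappa> * ?C\<close> is nonnegative; adding it gives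
    the square in the stated rate.\<close>
  also have "\<dots> \<le> (1 + \<kappa>)\<^sup>2 * ?C"
    using \<kappa>(1) C by (simp add: power2_eq_square algebra_simps)
  finally show "(\<Sum>i\<in>T. (r i)\<^sup>2) \<le> (1 + \<kappa>)\<^sup>2 * ?C" .
qed

section \<open>The iteration and its contraction\<close>

text \<open>The start fits as well, since \<open>sgn 0 = 0\<close> makes 0 shrink to 0. Hence the
  Bregman estimates for \<open>shrink l s\<close> apply to every iterate.\<close>

lemma raska_primal_eq_shrink:
  assumes "l \<ge> 0"
  shows "raska_primal l q w A b k = shrink l (raska_dual l q w A b k)"
  unfolding raska_primal_def raska_dual_def
  using assms by (cases k) (auto simp: shrink_def vec_eq_iff Let_def split: prod.split)

lemma raska_dual_Suc:
  fixes A :: "real^'n^'m" and b :: "real^'m" and l q w :: real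
  defines "x \<equiv> raska_primal l q w A b"
  shows "raska_dual l q w A b (Suc k) = raska_dual l q w A b k
    - (w / real (card (accepted q A b (x k))))
      *\<^sub>R (\<Sum>i\<in>accepted q A b (x k). (row i A \<bullet> x k - b $ i) *\<^sub>R row i A)"
  unfolding x_def raska_primal_def raska_dual_def by (simp add: Let_def split: prod.split)

theorem theorem4:
  fixes A :: "real^'n^'m" and xhat :: "real^'n" and b btilde bc :: "real^'m"
    and l \<beta> q w \<gamma> :: real
  assumes full_rank: "rank A = min CARD('m) CARD('n)"
    and unit_rows: "\<And>i. norm (row i A) = 1"
    and xhat: "xhat \<noteq> 0"
    and btilde: "btilde = A *v xhat"
    and b: "b = btilde + bc"
    and corruptions: "real (norm0 bc) = \<beta> * real CARD('m)"
    and integral: "\<beta> * real CARD('m) \<in> \<int>" "q * real CARD('m) \<in> \<int>"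
    and l: "l > 0"
    and q: "\<beta> < q" "q < 1 - \<beta>"
    and \<gamma>: "\<gamma> = 1 / (sigma_tilde_min A)\<^sup>2 * ((abs_min xhat + 2 * l) / abs_min xhat)"
    and w: "w > 0"
    and rate_pos:
      "0 < w / (\<gamma> * q * real CARD('m))
             * ((sigma_rows_min (q - \<beta>) A)\<^sup>2 / (sigma_max A)\<^sup>2 - sqrt \<beta> / sqrt (1 - q - \<beta>))
           - w\<^sup>2 * (sigma_max A)\<^sup>2 / (\<gamma> * q\<^sup>2 * (real CARD('m))\<^sup>2)
             * (1 + sqrt \<beta> / sqrt (1 - q - \<beta>))\<^sup>2"
    and rate_less_1:
      "w / (\<gamma> * q * real CARD('m))
             * ((sigma_rows_min (q - \<beta>) A)\<^sup>2 / (sigma_max A)\<^sup>2 - sqrt \<beta> / sqrt (1 - q - \<beta>))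
           - w\<^sup>2 * (sigma_max A)\<^sup>2 / (\<gamma> * q\<^sup>2 * (real CARD('m))\<^sup>2)
             * (1 + sqrt \<beta> / sqrt (1 - q - \<beta>))\<^sup>2 < 1"
    and eta: "\<And>k. real (card (accepted q A b (raska_primal l q w A b k))) = q * real CARD('m)"
  shows "\<forall>k. bregman (obj l) (raska_dual l q w A b (Suc k)) (raska_primal l q w A b (Suc k)) xhat
      \<le> (1 - w / (\<gamma> * q * real CARD('m))
             * ((sigma_rows_min (q - \<beta>) A)\<^sup>2 / (sigma_max A)\<^sup>2 - sqrt \<beta> / sqrt (1 - q - \<beta>))
           + w\<^sup>2 * (sigma_max A)\<^sup>2 / (\<gamma> * q\<^sup>2 * (real CARD('m))\<^sup>2)
             * (1 + sqrt \<beta> / sqrt (1 - q - \<beta>))\<^sup>2)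
        * bregman (obj l) (raska_dual l q w A b k) (raska_primal l q w A b k) xhat"
proof
  fix k
  define M \<sigma> \<kappa> where "M = real CARD('m)" and "\<sigma> = sigma_max A"
    and "\<kappa> = sqrt \<beta> / sqrt (1 - q - \<beta>)"
  define s x where "s = raska_dual l q w A b k" and "x = raska_primal l q w A b k"
  define T where "T = accepted q A b x"
  define u c r where "u = x - xhat" and "c = (\<lambda>i. row i A \<bullet> u)" and "r = (\<lambda>i. row i A \<bullet> x - b $ i)"
  define B where "B = {i. bc $ i \<noteq> 0}"
  define C where "C = (\<Sum>i\<in>UNIV. (c i)\<^sup>2)"
  define D where "D = bregman (obj l) s x xhat"
  define \<rho> where "\<rho> = (sigma_rows_min (q - \<beta>) A)\<^sup>2 / \<sigma>\<^sup>2 - \<kappa>"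
  have M: "M > 0" by (simp add: M_def)
  have cardB: "real (card B) = \<beta> * M" using corruptions by (simp add: B_def M_def norm0_def)
  have cardT: "real (card T) = q * M" using eta[of k] by (simp add: T_def x_def M_def)
  have \<beta>: "\<beta> \<ge> 0" using cardB M by (metis of_nat_0_le_iff zero_le_mult_iff not_less)
  have q0: "q > 0" using \<beta> q by simp
  have qM: "q * M > 0" using q0 M by simp
  have \<kappa>: "\<kappa> \<ge> 0" using \<beta> q by (simp add: \<kappa>_def)
  \<comment> \<open>\<open>undefined\<close> serves as an arbitrary row index.\<close>
  have A0: "A \<noteq> 0"
  proof
    assume "A = 0"
    then have "norm (row undefined A) = 0" by (simp add: row_def vec_eq_iff)
    then show False using unit_rows by simp
  qed
  have C: "C = (norm (A *v u))\<^sup>2"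
    by (simp add: C_def c_def power2_norm_eq_sum matrix_vector_mul_component row_def inner_vec_def
        matrix_vector_mult_def)
  have x: "x = shrink l s" unfolding x_def s_def using l by (simp add: raska_primal_eq_shrink)
  \<comment> \<open>\<open>g\<close> is the decrease per unit of \<open>C\<close>, the squared norm
    of \<open>A *v u\<close>; the contraction rate is \<open>g / \<gamma>\<close>.\<close>
  define g where "g = w / (q * M) * \<rho> - w\<^sup>2 * \<sigma>\<^sup>2 / (q\<^sup>2 * M\<^sup>2) * (1 + \<kappa>)\<^sup>2"
  have rate: "w / (\<gamma> * q * M) * \<rho> - w\<^sup>2 * \<sigma>\<^sup>2 / (\<gamma> * q\<^sup>2 * M\<^sup>2) * (1 + \<kappa>)\<^sup>2 = g / \<gamma>"
    unfolding g_def by (simp add: diff_divide_distrib mult_ac)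
  have g\<gamma>: "0 < g / \<gamma>" using rate_pos unfolding rate[symmetric] \<rho>_def \<sigma>_def \<kappa>_def M_def .
  have am: "abs_min xhat > 0" using abs_min_pos xhat by blast
  \<comment> \<open>As division by zero yields 0, \<open>\<gamma> = 0\<close> would make the rate 0,
    against its positivity. In the same way a vanishing \<open>sigma_tilde_min A\<close> would force
    \<open>\<gamma> = 0\<close>.\<close>
  have "\<gamma> \<ge> 0" unfolding \<gamma> using am l by simp
  with g\<gamma> have \<gamma>0: "\<gamma> > 0" by (cases "\<gamma> = 0") auto
  with g\<gamma> have g: "g > 0" by (simp add: zero_less_divide_iff)
  have st: "sigma_tilde_min A > 0"
  proof -
    have "sigma_tilde_min A \<noteq> 0" using \<gamma>0 \<gamma> by auto
    then show ?thesis using sigma_tilde_min_nonneg[OF A0] by simp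
  qed
  have D: "D \<le> \<gamma> * C"
  proof -
    have "(sigma_tilde_min A * norm u)\<^sup>2 \<le> C"
      unfolding C by (rule power_mono[OF sigma_tilde_min_le[OF A0]]) (use st in simp)
    then have u: "(norm u)\<^sup>2 \<le> C / (sigma_tilde_min A)\<^sup>2"
      using st by (simp add: power_mult_distrib field_simps)
    have "D \<le> (1 / 2 + 2 * l / abs_min xhat) * (norm u)\<^sup>2"
      unfolding D_def u_def x by (rule bregman_shrink_le_norm) (use l xhat in auto)
    \<comment> \<open>The constant \<open>1 / 2\<close> is enlarged to 1 to match the factor in
      \<open>\<gamma>\<close>.\<close>
    also have "\<dots> \<le> ((abs_min xhat + 2 * l) / abs_min xhat) * (norm u)\<^sup>2"
      by (rule mult_right_mono) (use am in \<open>simp_all add: field_simps\<close>)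
    also have "\<dots> \<le> ((abs_min xhat + 2 * l) / abs_min xhat) * (C / (sigma_tilde_min A)\<^sup>2)"
      by (rule mult_left_mono[OF u]) (use am l in simp)
    also have "\<dots> = \<gamma> * C" unfolding \<gamma> by simp
    finally show ?thesis .
  qed
  have rc: "r i = c i" if "i \<notin> B" for i
    using that unfolding r_def c_def B_def u_def b btilde
    by (simp add: matrix_vector_mult_def row_def inner_vec_def right_diff_distrib sum_subtractf)
  have T: "i \<in> T \<longleftrightarrow> \<bar>r i\<bar> < quantile q (abs_residuals A b x)" for i
    by (simp add: T_def accepted_def r_def) (simp add: abs_residuals_def)
  have Tne: "T \<noteq> {}" using cardT qM by auto
  have rB: "(\<Sum>i\<in>T \<inter> B. (r i)\<^sup>2) \<le> \<kappa>\<^sup>2 * (\<Sum>i\<in>- T - B. (c i)\<^sup>2)"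
    unfolding \<kappa>_def
    by (rule accepted_corrupted_le[OF rc T Tne]) (use cardT cardB q in \<open>auto simp: M_def\<close>)
  have cr: "(\<Sum>i\<in>T - B. (c i)\<^sup>2) - \<kappa> * C \<le> (\<Sum>i\<in>T. c i * r i)"
    and rr: "(\<Sum>i\<in>T. (r i)\<^sup>2) \<le> (1 + \<kappa>)\<^sup>2 * C"
    unfolding C_def by (rule accepted_sums_bounds[OF rc \<kappa> rB]; assumption)+
  have rows: "(sigma_rows_min (q - \<beta>) A)\<^sup>2 / \<sigma>\<^sup>2 * C \<le> (\<Sum>i\<in>T - B. (c i)\<^sup>2)"
  proof -
    \<comment> \<open>This keeps the natural-number difference \<open>card T - card B\<close> exact.
      It equals \<open>(q - \<beta>) * M\<close> and bounds the size of \<open>T - B\<close> from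
      below.\<close>
    have "card B \<le> card T" using cardT cardB q(1) M by (metis less_eq_real_def mult_right_mono of_nat_le_iff)
    then have p: "(q - \<beta>) * real CARD('m) = real (card T - card B)"
      using cardT cardB by (simp add: M_def of_nat_diff left_diff_distrib)
    have "(sigma_rows_min (q - \<beta>) A)\<^sup>2 * (norm u)\<^sup>2 \<le> (\<Sum>i\<in>T - B. (c i)\<^sup>2)"
      unfolding c_def by (rule sigma_rows_min_le[OF p]) (simp add: diff_card_le_card_Diff)
    moreover have "C / \<sigma>\<^sup>2 \<le> (norm u)\<^sup>2"
    \<comment> \<open>For \<open>\<sigma> = 0\<close> the quotient on the left is 0 by
      convention.\<close>
    proof (cases "\<sigma> = 0")
      case False
      have "C \<le> (\<sigma> * norm u)\<^sup>2"
        unfolding C \<sigma>_def by (rule power_mono[OF norm_matrix_vector_le_sigma_max]) simp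
      then show ?thesis using False by (simp add: power_mult_distrib field_simps)
    qed simp
    then have "(sigma_rows_min (q - \<beta>) A)\<^sup>2 * (C / \<sigma>\<^sup>2) \<le> (sigma_rows_min (q - \<beta>) A)\<^sup>2 * (norm u)\<^sup>2"
      by (rule mult_left_mono) simp
    ultimately show ?thesis by simp
  qed
  have crC: "\<rho> * C \<le> (\<Sum>i\<in>T. c i * r i)"
    using cr rows unfolding \<rho>_def by (simp add: left_diff_distrib)
  define d where "d = (\<Sum>i\<in>T. r i *\<^sub>R row i A)"
  have ud: "u \<bullet> d = (\<Sum>i\<in>T. c i * r i)"
    unfolding d_def c_def by (simp add: inner_sum_right inner_commute mult.commute)
  have dn: "(norm d)\<^sup>2 \<le> \<sigma>\<^sup>2 * ((1 + \<kappa>)\<^sup>2 * C)"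
    using norm_sum_rows_le_sigma_max[of r A T] mult_left_mono[OF rr, of "\<sigma>\<^sup>2"]
    unfolding d_def \<sigma>_def by simp
  define h where "h = w / (q * M)"
  have h: "h > 0" using w qM by (simp add: h_def)
  have sS: "raska_dual l q w A b (Suc k) = s - h *\<^sub>R d"
    using raska_dual_Suc[of l q w A b k]
    unfolding s_def[symmetric] x_def[symmetric] T_def[symmetric] cardT h_def d_def r_def .
  have "bregman (obj l) (raska_dual l q w A b (Suc k)) (raska_primal l q w A b (Suc k)) xhat
    \<le> D + u \<bullet> (- (h *\<^sub>R d)) + (norm (h *\<^sub>R d))\<^sup>2 / 2"
    using bregman_shrink_descent[of l "s - h *\<^sub>R d" xhat s] l
    unfolding raska_primal_eq_shrink[OF less_imp_le[OF l]] sS D_def u_def x by simp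
  also have "\<dots> = D - h * (u \<bullet> d) + h\<^sup>2 * (norm d)\<^sup>2 / 2"
    using h by (simp add: power_mult_distrib)
  \<comment> \<open>The factor \<open>1 / 2\<close> of the quadratic term is given away here, as the
    stated rate does not carry it.\<close>
  also have "\<dots> \<le> D - h * (\<rho> * C) + h\<^sup>2 * (\<sigma>\<^sup>2 * ((1 + \<kappa>)\<^sup>2 * C))"
  proof -
    have "h * (\<rho> * C) \<le> h * (u \<bullet> d)" unfolding ud by (rule mult_left_mono[OF crC]) (use h in simp)
    moreover have "h\<^sup>2 * (norm d)\<^sup>2 \<le> h\<^sup>2 * (\<sigma>\<^sup>2 * ((1 + \<kappa>)\<^sup>2 * C))"
      by (rule mult_left_mono[OF dn]) simp
    moreover have "0 \<le> h\<^sup>2 * (norm d)\<^sup>2" by simp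
    ultimately show ?thesis by linarith
  qed
  also have "\<dots> = D - g * C"
    unfolding g_def h_def by (simp add: power_divide power_mult_distrib algebra_simps)
  \<comment> \<open>Since \<open>g > 0\<close>, the bound \<open>D \<le> \<gamma> * C\<close> turns
    a decrease in terms of \<open>C\<close> into one proportional to \<open>D\<close>.\<close>
  also have "\<dots> \<le> D - g * (D / \<gamma>)"
  proof -
    have "D / \<gamma> \<le> C" using D \<gamma>0 by (simp add: field_simps)
    then have "g * (D / \<gamma>) \<le> g * C" by (rule mult_left_mono) (use g in simp)
    then show ?thesis by simp
  qed
  also have "\<dots> = (1 - g / \<gamma>) * D" by (simp add: algebra_simps)
  also have "\<dots> = (1 - w / (\<gamma> * q * M) * \<rho> + w\<^sup>2 * \<sigma>\<^sup>2 / (\<gamma> * q\<^sup>2 * M\<^sup>2) * (1 + \<kappa>)\<^sup>2) * D"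
    unfolding rate[symmetric] by (simp add: algebra_simps)
  finally show "bregman (obj l) (raska_dual l q w A b (Suc k)) (raska_primal l q w A b (Suc k)) xhat
      \<le> (1 - w / (\<gamma> * q * real CARD('m))
             * ((sigma_rows_min (q - \<beta>) A)\<^sup>2 / (sigma_max A)\<^sup>2 - sqrt \<beta> / sqrt (1 - q - \<beta>))
           + w\<^sup>2 * (sigma_max A)\<^sup>2 / (\<gamma> * q\<^sup>2 * (real CARD('m))\<^sup>2)
             * (1 + sqrt \<beta> / sqrt (1 - q - \<beta>))\<^sup>2)
        * bregman (obj l) (raska_dual l q w A b k) (raska_primal l q w A b k) xhat"
    unfolding M_def \<rho>_def \<sigma>_def \<kappa>_def D_def s_def x_def .
qed

end
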